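(* For every integer $n\ge 1$, the Mostar index of the Lucas cube $\Lambda_n$ is given by $$\mathrm{Mo}(\Lambda_n)=n\,f_n\,f_{n-1}.$$
   Context: Fibonacci numbers: $f_0=0$, $f_1=1$, $f_n=f_{n-1}+f_{n-2}$ for $n\ge 2$. Lucas cube: for $n\ge 1$, $\Lambda_n$ is the graph whose vertices are the binary strings $b_1b_2\ldots b_n\in\{0,1\}^n$ with $b_i\cdot b_{i+1}=0$ for all $1\le i\le n-1$ and also $b_1\cdot b_n=0$ (so for $n=1$ the only vertex is the string $0$), two vertices being adjacent if and only if they differ in exactly one coordinate (i.e. the subgraph of the $n$-dimensional hypercube induced by these strings). Mostar index: for a graph $G$ and an edge $uv\in E(G)$, $n_u(G)$ is the number of vertices of $G$ that are strictly closer (in the shortest path metric of $G$) to $u$ than to $v$, and $n_v(G)$ is the number of vertices strictly closer to $v$ than to $u$. The Mostar index is $\mathrm{Mo}(G)=\sum_{uv\in E(G)}|n_u(G)-n_v(G)|$, the sum being over (unordered) edges. *)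

theory Defs
  imports
    "Graph_Theory.Pair_Digraph"
    "Graph_Theory.Shortest_Path"
    "HOL-Number_Theory.Fib"
begin

text \<open>
  A finite simple graph is a \<^locale>\<open>pair_graph\<close>: a finite symmetric loop-free
  digraph whose arcs are pairs of vertices, so that each undirected edge \<open>uv\<close> is
  represented by the two arcs \<open>(u, v)\<close> and \<open>(v, u)\<close>.
\<close>

definition graph_dist :: "'a pair_pre_digraph \<Rightarrow> 'a \<Rightarrow> 'a \<Rightarrow> ereal" where
  "graph_dist G u v = wf_digraph.\<mu> (with_proj G) (\<lambda>_. 1) u v"

definition n_closer :: "'a pair_pre_digraph \<Rightarrow> 'a \<Rightarrow> 'a \<Rightarrow> nat" where
  "n_closer G u v = card {w \<in> pverts G. graph_dist G w u < graph_dist G w v}"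

definition undirected_edges :: "'a pair_pre_digraph \<Rightarrow> 'a set set" where
  "undirected_edges G = {{u, v} | u v. (u, v) \<in> parcs G}"

text \<open>
  The contribution of an edge does not depend on the order of its endpoints, so the
  description below is a proper one; see \<open>edge_imbalance_doubleton\<close>.
\<close>

definition edge_imbalance :: "'a pair_pre_digraph \<Rightarrow> 'a set \<Rightarrow> int" where
  "edge_imbalance G e =
     (THE k. \<exists>u v. e = {u, v} \<and> k = \<bar>int (n_closer G u v) - int (n_closer G v u)\<bar>)"

lemma edge_imbalance_doubleton:
  "edge_imbalance G {u, v} = \<bar>int (n_closer G u v) - int (n_closer G v u)\<bar>"
  unfolding edge_imbalance_def
  by (rule the_equality) (auto simp: doubleton_eq_iff abs_minus_commute)

definition mostar_index :: "'a pair_pre_digraph \<Rightarrow> int" where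
  "mostar_index G = (\<Sum>e\<in>undirected_edges G. edge_imbalance G e)"

text \<open>
  Strings \<open>b\<^sub>1 \<dots> b\<^sub>n\<close> are lists, so \<open>b\<^sub>i\<close> is \<open>b ! (i - 1)\<close>. For \<open>n = 1\<close> the
  condition on the first and last letter compares \<open>b\<^sub>1\<close> with itself and excludes
  the string \<open>1\<close>. The value at \<open>n = 0\<close> has no significance.
\<close>

definition lucas_strings :: "nat \<Rightarrow> nat list set" where
  "lucas_strings n =
     {b. length b = n \<and> set b \<subseteq> {0, 1} \<and>
         (\<forall>i. Suc i < n \<longrightarrow> b ! i * b ! Suc i = 0) \<and>
         b ! 0 * b ! (n - 1) = 0}"

definition lucas_cube :: "nat \<Rightarrow> nat list pair_pre_digraph" where
  "lucas_cube n =
     \<lparr>pverts = lucas_strings n,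
      parcs = {(u, v). u \<in> lucas_strings n \<and> v \<in> lucas_strings n \<and>
                       card {i. i < n \<and> u ! i \<noteq> v ! i} = 1}\<rparr>"

lemma finite_lucas_strings: "finite (lucas_strings n)"
proof (rule finite_subset)
  show "lucas_strings n \<subseteq> {b. set b \<subseteq> {0, 1} \<and> length b = n}"
    by (auto simp: lucas_strings_def)
  show "finite {b. set b \<subseteq> {0, 1 :: nat} \<and> length b = n}"
    by (rule finite_lists_length_eq) simp
qed

lemma pair_graph_lucas_cube: "pair_graph (lucas_cube n)"
proof
  show "finite (parcs (lucas_cube n))"
    by (rule finite_subset[of _ "lucas_strings n \<times> lucas_strings n"])
       (auto simp: lucas_cube_def finite_lucas_strings)
  show "symmetric (with_proj (lucas_cube n))"
    unfolding symmetric_def with_proj_simps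
    by (rule symI) (auto simp: lucas_cube_def eq_commute)
qed (auto simp: lucas_cube_def finite_lucas_strings)

end

theory Submission
  imports Defs
begin

text \<open>
  The Lucas strings are closed under turning ones into zeros. Hence the cube has no
  detours: to get from \<open>u\<close> to \<open>v\<close>, first clear the ones of \<open>u\<close> that are
  missing in \<open>v\<close>, and then set the remaining ones of \<open>v\<close>; every string on
  the way lies below \<open>u\<close> or below \<open>v\<close>. So the distance is the Hamming
  distance (\<open>graph_dist_lucas_cube\<close>).

  An edge therefore splits the vertices by a single letter. Let its endpoints be \<open>w\<close>
  with \<open>w ! k = 1\<close> and \<open>w[k := 0]\<close>. A vertex \<open>x\<close> is closer to the endpoint
  that it agrees with at position \<open>k\<close>, and there are no ties
  (\<open>n_closer_lucas_cube\<close>). By rotation it is enough to count at position \<open>0\<close>.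
  A Lucas string that starts with \<open>0\<close> continues with an arbitrary string of length
  \<open>n - 1\<close> without two consecutive ones, and there are \<open>fib (n + 1)\<close> of those; one
  that starts with \<open>1\<close> is \<open>1 0 x 0\<close> with such a string \<open>x\<close> of length
  \<open>n - 3\<close> if \<open>n \<ge> 3\<close>, which gives \<open>fib (n - 1)\<close>, and this value is also
  right for \<open>n = 1\<close> and \<open>n = 2\<close>. Every edge thus contributes
  \<open>fib (n + 1) - fib (n - 1) = fib n\<close>.

  Finally, an edge is determined by its position \<open>k\<close> and its upper endpoint
  \<open>w\<close>, an arbitrary vertex with \<open>w ! k = 1\<close>. So there are
  \<open>n * fib (n - 1)\<close> edges, and the product is the claim.
\<close>

section \<open>Membership in the Lucas cube\<close>

text \<open>
  Reading successors modulo \<open>n\<close> merges the condition on neighbours with the one on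
  the two ends. In this form the definition is visibly invariant under rotation.
\<close>

lemma lucas_strings_cyclic:
  assumes "n \<ge> 1"
  shows "b \<in> lucas_strings n \<longleftrightarrow>
    length b = n \<and> (\<forall>i<n. b ! i \<le> 1) \<and> (\<forall>i<n. b ! i * b ! (Suc i mod n) = 0)"
proof (cases "length b = n")
  case True
  have letters: "set b \<subseteq> {0, 1} \<longleftrightarrow> (\<forall>i<n. b ! i \<le> 1)"
  proof -
    have "set b \<subseteq> {0, 1} \<longleftrightarrow> (\<forall>x\<in>set b. x \<le> 1)"
      by (auto simp: subset_iff le_Suc_eq)
    then show ?thesis
      using True by (simp add: all_set_conv_all_nth)
  qed
  have "(\<forall>i<n. b ! i * b ! (Suc i mod n) = 0) \<longleftrightarrow>
    (\<forall>i. Suc i < n \<longrightarrow> b ! i * b ! Suc i = 0) \<and> b ! 0 * b ! (n - 1) = 0"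
    (is "?cyclic \<longleftrightarrow> ?path \<and> ?wrap")
  proof
    assume cyclic: ?cyclic
    have ?path
      using cyclic by (metis Suc_lessD mod_less)
    moreover have ?wrap
      using cyclic[rule_format, of "n - 1"] assms by (simp add: mult.commute)
    ultimately show "?path \<and> ?wrap" ..
  next
    assume *: "?path \<and> ?wrap"
    show ?cyclic
    proof (intro allI impI)
      fix i assume "i < n"
      show "b ! i * b ! (Suc i mod n) = 0"
      proof (cases "Suc i < n")
        case True
        then show ?thesis using * by simp
      next
        case False
        then have "Suc i = n" using \<open>i < n\<close> by simp
        then show ?thesis using * by auto
      qed
    qed
  qed
  then show ?thesis
    using True letters by (simp add: lucas_strings_def)
qed (simp add: lucas_strings_def)

lemma length_lucas_string: "b \<in> lucas_strings n \<Longrightarrow> length b = n"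
  by (simp add: lucas_strings_def)

lemma lucas_string_letter:
  assumes "b \<in> lucas_strings n" "i < n"
  shows "b ! i = 0 \<or> b ! i = 1"
  using assms nth_mem[of i b] by (auto simp: lucas_strings_def simp del: nth_mem)

lemma lucas_strings_downward_closed:
  assumes "n \<ge> 1" and v: "v \<in> lucas_strings n" and len: "length u = n"
    and le: "\<And>i. i < n \<Longrightarrow> u ! i \<le> v ! i"
  shows "u \<in> lucas_strings n"
  unfolding lucas_strings_cyclic[OF \<open>n \<ge> 1\<close>]
proof (intro conjI allI impI)
  fix i assume "i < n"
  then have "Suc i mod n < n" by simp
  have "v ! i * v ! (Suc i mod n) = 0" "v ! i \<le> 1"
    using v \<open>i < n\<close> by (simp_all add: lucas_strings_cyclic[OF \<open>n \<ge> 1\<close>])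
  then show "u ! i * u ! (Suc i mod n) = 0" "u ! i \<le> 1"
    using le[OF \<open>i < n\<close>] le[OF \<open>Suc i mod n < n\<close>] by auto
qed (rule len)

text \<open>
  Unlike \<open>nth_list_update\<close>, this bounds the position that is read and not the one
  that is written.
\<close>

lemma nth_list_update_read:
  "i < length w \<Longrightarrow> w[k := a] ! i = (if i = k then a else w ! i)"
  by (cases "i = k") simp_all

lemma lucas_strings_clear:
  assumes "n \<ge> 1" "w \<in> lucas_strings n"
  shows "w[k := 0] \<in> lucas_strings n"
  by (rule lucas_strings_downward_closed[OF assms])
     (use assms in \<open>simp_all add: length_lucas_string nth_list_update_read\<close>)

lemma rotate_lucas_string:
  assumes "n \<ge> 1" "b \<in> lucas_strings n"
  shows "rotate m b \<in> lucas_strings n"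
proof -
  have len: "length b = n" and "n > 0"
    using assms by (auto simp: length_lucas_string)
  have "rotate m b ! i = b ! ((m + i) mod n)"
       "rotate m b ! (Suc i mod n) = b ! (Suc ((m + i) mod n) mod n)" if "i < n" for i
    using that \<open>n > 0\<close>
    by (simp_all add: nth_rotate len mod_add_right_eq mod_Suc_eq)
  then show ?thesis
    using assms(2) \<open>n > 0\<close> by (simp add: lucas_strings_cyclic[OF assms(1)])
qed

section \<open>Distances\<close>

text \<open>
  The Hamming distance is the cardinality. The set itself is the better notion here,
  because the arguments below change one position at a time.
\<close>

definition differing :: "nat list \<Rightarrow> nat list \<Rightarrow> nat set" where
  "differing u v = {i. i < length u \<and> u ! i \<noteq> v ! i}"

lemma finite_differing [simp]: "finite (differing u v)"
  by (simp add: differing_def)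

lemma arc_lucas_cube_iff:
  "(u, v) \<in> parcs (lucas_cube n) \<longleftrightarrow>
    u \<in> lucas_strings n \<and> v \<in> lucas_strings n \<and> card (differing u v) = 1"
  by (auto simp: lucas_cube_def differing_def length_lucas_string)

lemma differing_eq_empty_iff:
  "length u = length v \<Longrightarrow> differing u v = {} \<longleftrightarrow> u = v"
  by (auto simp: differing_def list_eq_iff_nth_eq)

lemma card_differing_triangle:
  assumes "length u = length v"
  shows "card (differing u w) \<le> card (differing u v) + card (differing v w)"
proof -
  have "differing u w \<subseteq> differing u v \<union> differing v w"
    using assms by (auto simp: differing_def)
  then have "card (differing u w) \<le> card (differing u v \<union> differing v w)"
    by (rule card_mono[rotated]) simp
  also have "\<dots> \<le> card (differing u v) + card (differing v w)"
    by (rule card_Un_le)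
  finally show ?thesis .
qed

text \<open>
  Clearing a surplus one of \<open>u\<close> stays below \<open>u\<close>. If there is none, then
  \<open>u\<close> lies below \<open>v\<close>, and it still does after a missing one is set. Ones
  must be cleared first: setting one too early may put it next to a one of \<open>u\<close>.
\<close>

lemma lucas_string_step_towards:
  assumes "n \<ge> 1" and u: "u \<in> lucas_strings n" and v: "v \<in> lucas_strings n"
    and "u \<noteq> v"
  obtains u' where "(u, u') \<in> parcs (lucas_cube n)"
    "card (differing u v) = Suc (card (differing u' v))"
proof -
  have len: "length u = n" "length v = n"
    using u v by (simp_all add: length_lucas_string)
  obtain i where i: "i < n" "u ! i \<noteq> v ! i" and u': "u[i := v ! i] \<in> lucas_strings n"
  proof (cases "\<exists>i<n. v ! i < u ! i")
    case True
    then obtain i where i: "i < n" "v ! i < u ! i" by blast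
    then have "v ! i = 0" using lucas_string_letter[OF u] by fastforce
    then show ?thesis
      using that[of i] i lucas_strings_clear[OF \<open>n \<ge> 1\<close> u, of i] by simp
  next
    case False
    then have le: "u ! j \<le> v ! j" if "j < n" for j using that by (meson leI)
    obtain i where i: "i < n" "u ! i \<noteq> v ! i"
      using \<open>u \<noteq> v\<close> len by (auto simp: list_eq_iff_nth_eq)
    have "u[i := v ! i] \<in> lucas_strings n"
      by (rule lucas_strings_downward_closed[OF \<open>n \<ge> 1\<close> v])
         (simp_all add: len nth_list_update_read le)
    then show ?thesis using that i by blast
  qed
  have "differing u (u[i := v ! i]) = {i}"
    using i by (auto simp: differing_def len nth_list_update)
  then have "(u, u[i := v ! i]) \<in> parcs (lucas_cube n)"
    using u u' by (simp add: arc_lucas_cube_iff)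
  moreover have "differing u v = insert i (differing (u[i := v ! i]) v)"
    "i \<notin> differing (u[i := v ! i]) v"
    using i by (auto simp: differing_def len nth_list_update split: if_splits)
  then have "card (differing u v) = Suc (card (differing (u[i := v ! i]) v))"
    by simp
  ultimately show ?thesis using that by blast
qed

text \<open>
  An arc changes one letter, so no walk is shorter than the Hamming distance. Repeated
  steps towards \<open>v\<close> give a walk of that length.
\<close>

lemma graph_dist_lucas_cube:
  assumes "n \<ge> 1" and u: "u \<in> lucas_strings n" and v: "v \<in> lucas_strings n"
  shows "graph_dist (lucas_cube n) u v = card (differing u v)"
proof -
  interpret pair_graph "lucas_cube n" by (rule pair_graph_lucas_cube)
  have verts: "pverts (lucas_cube n) = lucas_strings n"
    by (simp add: lucas_cube_def)
  have cost: "awalk_cost (\<lambda>_. 1) p = length p" for p :: "(nat list \<times> nat list) list"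
    by (induction p) simp_all
  have lower: "card (differing u v) \<le> length p" if "awalk u p v" for u p
    using that
  proof (induction p arbitrary: u)
    case Nil
    then show ?case by (simp add: awalk_Nil_iff differing_def)
  next
    case (Cons e p)
    then obtain u' where e: "e = (u, u')" "(u, u') \<in> parcs (lucas_cube n)"
      and p: "awalk u' p v"
      by (cases e) (auto simp: awalk_Cons_iff)
    have "card (differing u v) \<le> card (differing u u') + card (differing u' v)"
      using e by (intro card_differing_triangle)
        (auto simp: arc_lucas_cube_iff length_lucas_string)
    then show ?case
      using Cons.IH[OF p] e by (simp add: arc_lucas_cube_iff)
  qed
  have upper: "\<exists>p. awalk u p v \<and> length p = card (differing u v)"
    if "u \<in> lucas_strings n" for u
    using that
  proof (induction "card (differing u v)" arbitrary: u)
    case 0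
    then have "u = v"
      using v by (simp add: differing_eq_empty_iff length_lucas_string)
    then show ?case
      using v by (intro exI[of _ "[]"]) (auto simp: awalk_Nil_iff differing_def verts)
  next
    case (Suc m)
    then have "u \<noteq> v" by (auto simp: differing_def)
    then obtain u' where u': "(u, u') \<in> parcs (lucas_cube n)"
      "card (differing u v) = Suc (card (differing u' v))"
      using lucas_string_step_towards[OF \<open>n \<ge> 1\<close> Suc.prems v] by blast
    then obtain p where "awalk u' p v" "length p = card (differing u' v)"
      using Suc.hyps by (fastforce simp: arc_lucas_cube_iff)
    then show ?case
      using u' by (intro exI[of _ "(u, u') # p"]) (simp add: awalk_Cons_iff)
  qed
  obtain p where p: "awalk u p v" "length p = card (differing u v)"
    using upper[OF u] by blast
  show ?thesis
    unfolding graph_dist_def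
  proof (rule antisym)
    show "\<mu> (\<lambda>_. 1) u v \<le> card (differing u v)"
      using min_cost_le_walk_cost[OF p(1), of "\<lambda>_. 1"] p(2) by (simp add: cost)
    show "card (differing u v) \<le> \<mu> (\<lambda>_. 1) u v"
      unfolding \<mu>_def by (rule INF_greatest) (use lower in \<open>simp add: cost\<close>)
  qed
qed

section \<open>Edges\<close>

text \<open>
  Only position \<open>k\<close> matters when the Hamming distances from \<open>x\<close> to the two
  ends of an edge are compared.
\<close>

lemma differing_clear:
  assumes "k < length w" "w ! k = 1" "length x = length w"
  shows "x ! k = 0 \<Longrightarrow> card (differing x w) = Suc (card (differing x (w[k := 0])))"
    and "x ! k = 1 \<Longrightarrow> card (differing x (w[k := 0])) = Suc (card (differing x w))"
proof -
  assume "x ! k = 0"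
  then have "differing x w = insert k (differing x (w[k := 0]))" "k \<notin> differing x (w[k := 0])"
    using assms by (auto simp: differing_def nth_list_update split: if_splits)
  then show "card (differing x w) = Suc (card (differing x (w[k := 0])))" by simp
next
  assume "x ! k = 1"
  then have "differing x (w[k := 0]) = insert k (differing x w)" "k \<notin> differing x w"
    using assms by (auto simp: differing_def nth_list_update split: if_splits)
  then show "card (differing x (w[k := 0])) = Suc (card (differing x w))" by simp
qed

lemma n_closer_lucas_cube:
  assumes "n \<ge> 1" "k < n" and w: "w \<in> lucas_strings n" and "w ! k = 1"
  shows "n_closer (lucas_cube n) (w[k := 0]) w = card {x \<in> lucas_strings n. x ! k = 0}"
    and "n_closer (lucas_cube n) w (w[k := 0]) = card {x \<in> lucas_strings n. x ! k = 1}"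
proof -
  have verts: "pverts (lucas_cube n) = lucas_strings n"
    by (simp add: lucas_cube_def)
  note w0 = lucas_strings_clear[OF \<open>n \<ge> 1\<close> w, of k]
  have closer:
    "graph_dist (lucas_cube n) x (w[k := 0]) < graph_dist (lucas_cube n) x w \<longleftrightarrow> x ! k = 0"
    "graph_dist (lucas_cube n) x w < graph_dist (lucas_cube n) x (w[k := 0]) \<longleftrightarrow> x ! k = 1"
    if x: "x \<in> lucas_strings n" for x
  proof -
    have "length x = length w" "k < length w"
      using x w \<open>k < n\<close> by (simp_all add: length_lucas_string)
    then show
      "graph_dist (lucas_cube n) x (w[k := 0]) < graph_dist (lucas_cube n) x w \<longleftrightarrow> x ! k = 0"
      "graph_dist (lucas_cube n) x w < graph_dist (lucas_cube n) x (w[k := 0]) \<longleftrightarrow> x ! k = 1"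
      using lucas_string_letter[OF x \<open>k < n\<close>] differing_clear[of k w x] \<open>w ! k = 1\<close>
      by (auto simp: graph_dist_lucas_cube[OF \<open>n \<ge> 1\<close> x] w w0)
  qed
  show "n_closer (lucas_cube n) (w[k := 0]) w = card {x \<in> lucas_strings n. x ! k = 0}"
    "n_closer (lucas_cube n) w (w[k := 0]) = card {x \<in> lucas_strings n. x ! k = 1}"
    unfolding n_closer_def verts by (auto intro!: arg_cong[of _ _ card] simp: closer)
qed

text \<open>Arcs run in both directions; the two cases are those of a step up and a step down.\<close>

lemma arc_lucas_cube_cases:
  assumes "(u, v) \<in> parcs (lucas_cube n)"
  obtains k where "k < n" "v ! k = 1" "u = v[k := 0]"
    | k where "k < n" "u ! k = 1" "v = u[k := 0]"
proof -
  have u: "u \<in> lucas_strings n" and v: "v \<in> lucas_strings n"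
    using assms by (simp_all add: arc_lucas_cube_iff)
  obtain k where k: "differing u v = {k}"
    using assms by (auto simp: arc_lucas_cube_iff card_1_singleton_iff)
  have len: "length u = n" "length v = n"
    using u v by (simp_all add: length_lucas_string)
  have "k < n" "u ! k \<noteq> v ! k" and other: "\<And>i. i < n \<Longrightarrow> i \<noteq> k \<Longrightarrow> u ! i = v ! i"
    using k len by (auto simp: differing_def set_eq_iff)
  then consider "u ! k = 0" "v ! k = 1" | "u ! k = 1" "v ! k = 0"
    using lucas_string_letter[OF u] lucas_string_letter[OF v] by metis
  then show ?thesis
  proof cases
    case 1
    then have "u = v[k := 0]"
      using other len by (auto simp: list_eq_iff_nth_eq nth_list_update_read)
    then show ?thesis using that(1) 1 \<open>k < n\<close> by blast
  next
    case 2
    then have "v = u[k := 0]"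
      using other len by (auto simp: list_eq_iff_nth_eq nth_list_update_read)
    then show ?thesis using that(2) 2 \<open>k < n\<close> by blast
  qed
qed

lemma undirected_edges_lucas_cube:
  assumes "n \<ge> 1"
  shows "undirected_edges (lucas_cube n) =
    (\<lambda>(k, w). {w[k := 0], w}) ` (SIGMA k:{..<n}. {w \<in> lucas_strings n. w ! k = 1})"
    (is "_ = ?edge ` ?tops")
proof (intro equalityI subsetI)
  fix e assume "e \<in> undirected_edges (lucas_cube n)"
  then obtain u v where e: "e = {u, v}" and uv: "(u, v) \<in> parcs (lucas_cube n)"
    by (auto simp: undirected_edges_def)
  then have verts: "u \<in> lucas_strings n" "v \<in> lucas_strings n"
    by (simp_all add: arc_lucas_cube_iff)
  from uv show "e \<in> ?edge ` ?tops"
  proof (cases rule: arc_lucas_cube_cases)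
    case (1 k)
    then show ?thesis
      using e verts by (intro image_eqI[of _ _ "(k, v)"]) auto
  next
    case (2 k)
    then show ?thesis
      using e verts by (intro image_eqI[of _ _ "(k, u)"]) auto
  qed
next
  fix e assume "e \<in> ?edge ` ?tops"
  then obtain k w where e: "e = {w[k := 0], w}"
    and "k < n" and w: "w \<in> lucas_strings n" "w ! k = 1"
    by auto
  have "differing (w[k := 0]) w = {k}"
    using \<open>k < n\<close> w
    by (auto simp: differing_def nth_list_update length_lucas_string split: if_splits)
  then have "(w[k := 0], w) \<in> parcs (lucas_cube n)"
    using w lucas_strings_clear[OF assms w(1), of k] by (simp add: arc_lucas_cube_iff)
  then show "e \<in> undirected_edges (lucas_cube n)"
    using e by (auto simp: undirected_edges_def)
qed

text \<open>
  The upper endpoint of an edge is the one with more ones, so two descriptions of the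
  same edge cannot have exchanged endpoints.
\<close>

lemma inj_on_edge_top:
  "inj_on (\<lambda>(k, w). {w[k := 0], w}) (SIGMA k:{..<n}. {w \<in> lucas_strings n. w ! k = 1})"
proof (rule inj_onI, clarify)
  fix k w k' w'
  assume k: "k < n" "w \<in> lucas_strings n" "w ! k = 1"
    and k': "k' < n" "w' \<in> lucas_strings n" "w' ! k' = 1"
    and eq: "{w[k := 0], w} = {w'[k' := 0], w'}"
  have len: "length w = n" "length w' = n"
    using k k' by (simp_all add: length_lucas_string)
  have "w = w'"
  proof (rule ccontr)
    assume "w \<noteq> w'"
    then have swap: "w = w'[k' := 0]" "w[k := 0] = w'"
      using eq by (auto simp: doubleton_eq_iff)
    have "w ! k' = 0"
      using k'(1) len unfolding swap(1) by simp
    then have "w' ! k' = 0"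
      using k'(1) len unfolding swap(2)[symmetric] by (simp add: nth_list_update_read)
    then show False using k' by simp
  qed
  moreover from this have "w[k := 0] = w[k' := 0]"
    using eq by (auto simp: doubleton_eq_iff)
  then have "w[k' := 0] ! k = 0"
    using k(1) len by (metis nth_list_update_eq)
  then have "k = k'"
    using k(3) by (metis nth_list_update_neq zero_neq_one)
  ultimately show "k = k' \<and> w = w'" by simp
qed

section \<open>Counting Lucas strings by one letter\<close>

definition fibonacci_strings :: "nat \<Rightarrow> nat list set" where
  "fibonacci_strings m =
     {x. length x = m \<and> set x \<subseteq> {0, 1} \<and> successively (\<lambda>a b. a * b = 0) x}"

lemma finite_fibonacci_strings: "finite (fibonacci_strings m)"
proof (rule finite_subset)
  show "fibonacci_strings m \<subseteq> {b. set b \<subseteq> {0, 1} \<and> length b = m}"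
    by (auto simp: fibonacci_strings_def)
  show "finite {b. set b \<subseteq> {0, 1 :: nat} \<and> length b = m}"
    by (rule finite_lists_length_eq) simp
qed

lemma fibonacci_strings_0: "fibonacci_strings 0 = {[]}"
  by (auto simp: fibonacci_strings_def)

lemma fibonacci_strings_1: "fibonacci_strings (Suc 0) = {[0], [1]}"
  by (auto simp: fibonacci_strings_def length_Suc_conv)

text \<open>
  A leading one forces a zero after it. This is the source of the Fibonacci recurrence.
\<close>

lemma fibonacci_strings_Suc_Suc:
  "fibonacci_strings (Suc (Suc m)) =
     (#) 0 ` fibonacci_strings (Suc m) \<union> (\<lambda>x. 1 # 0 # x) ` fibonacci_strings m"
  by (auto simp: fibonacci_strings_def length_Suc_conv successively_Cons image_iff)

lemma card_fibonacci_strings: "card (fibonacci_strings m) = fib (Suc (Suc m))"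
proof (induction m rule: fib.induct)
  case (3 m)
  have "card (fibonacci_strings (Suc (Suc m))) =
      card ((#) 0 ` fibonacci_strings (Suc m)) + card ((\<lambda>x. 1 # 0 # x) ` fibonacci_strings m)"
    unfolding fibonacci_strings_Suc_Suc
    by (rule card_Un_disjoint) (auto simp: finite_fibonacci_strings)
  also have "\<dots> = fib (Suc (Suc (Suc m))) + fib (Suc (Suc m))"
    using 3 by (simp add: card_image inj_on_def)
  finally show ?case by simp
qed (simp_all add: fibonacci_strings_0 fibonacci_strings_1)

text \<open>
  The recursive predicate \<^const>\<open>successively\<close>, unlike indices, lets letters be split
  off at either end.
\<close>

lemma lucas_strings_iff_successively:
  assumes "n \<ge> 1"
  shows "b \<in> lucas_strings n \<longleftrightarrow>
    length b = n \<and> set b \<subseteq> {0, 1} \<and> successively (\<lambda>x y. x * y = 0) b \<and> hd b * last b = 0"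
proof -
  have succ: "successively P xs \<longleftrightarrow> (\<forall>i. Suc i < length xs \<longrightarrow> P (xs ! i) (xs ! Suc i))"
    for P and xs :: "nat list"
  proof (induction P xs rule: successively.induct)
    case (3 P x y xs)
    then show ?case by (auto simp: less_Suc_eq_0_disj)
  qed simp_all
  have "b \<noteq> []" if "length b = n" using that assms by auto
  then show ?thesis
    by (auto simp: lucas_strings_def succ hd_conv_nth last_conv_nth)
qed

lemma lucas_strings_head_0:
  "{b \<in> lucas_strings (Suc m). b ! 0 = 0} = (#) 0 ` fibonacci_strings m"
  by (auto simp: lucas_strings_iff_successively fibonacci_strings_def length_Suc_conv
      successively_Cons image_iff)

text \<open>
  Both cyclic neighbours of the leading one, the second and the last letter, are zero.
  They are distinct positions only from length three on.
\<close>

lemma lucas_strings_head_1: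
  "{b \<in> lucas_strings (Suc (Suc (Suc m))). b ! 0 = 1} =
     (\<lambda>x. 1 # 0 # x @ [0]) ` fibonacci_strings m" (is "?L = ?R")
proof (intro equalityI subsetI)
  fix b assume "b \<in> ?L"
  then obtain y z where b: "b = 1 # y # z" "length z = Suc m"
    by (auto simp: lucas_strings_iff_successively length_Suc_conv)
  then obtain x a where z: "z = x @ [a]" "length x = m"
    by (metis length_Suc_conv_rev)
  show "b \<in> ?R"
    using \<open>b \<in> ?L\<close> b z
    by (auto simp: lucas_strings_iff_successively fibonacci_strings_def
        successively_Cons successively_append_iff)
next
  fix b assume "b \<in> ?R"
  then show "b \<in> ?L"
    by (auto simp: lucas_strings_iff_successively fibonacci_strings_def
        successively_Cons successively_append_iff hd_append)
qed

lemma card_lucas_strings_letter: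
  assumes "k < n"
  shows "card {b \<in> lucas_strings n. b ! k = c} = card {b \<in> lucas_strings n. b ! 0 = c}"
proof (rule bij_betw_same_card)
  have "n \<ge> 1" using assms by simp
  (* Rotating by k brings position k to the front; n - k further rotations undo it. *)
  show "bij_betw (rotate k) {b \<in> lucas_strings n. b ! k = c} {b \<in> lucas_strings n. b ! 0 = c}"
    by (rule bij_betw_byWitness[of _ "rotate (n - k)"])
       (use assms in \<open>auto simp: rotate_rotate length_lucas_string nth_rotate
          rotate_lucas_string[OF \<open>n \<ge> 1\<close>]\<close>)
qed

lemma card_lucas_strings_0:
  assumes "k < n"
  shows "card {b \<in> lucas_strings n. b ! k = 0} = fib (Suc n)"
proof -
  obtain m where n: "n = Suc m" using assms by (cases n) auto
  show ?thesis
    unfolding card_lucas_strings_letter[OF assms] unfolding n lucas_strings_head_0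
    by (simp add: card_image card_fibonacci_strings)
qed

text \<open>
  For \<open>n \<ge> 3\<close> the middle part \<open>x\<close> of \<open>1 0 x 0\<close> is counted. In length one the string \<open>1\<close> is excluded because it is its own
  neighbour, and in length two only \<open>1 0\<close> remains.
\<close>

lemma card_lucas_strings_1:
  assumes "k < n"
  shows "card {b \<in> lucas_strings n. b ! k = 1} = fib (n - 1)"
proof -
  consider "n = 1" | "n = 2" | m where "n = Suc (Suc (Suc m))"
    using assms by (metis One_nat_def Suc_1 not0_implies_Suc not_less0)
  then have "card {b \<in> lucas_strings n. b ! 0 = 1} = fib (n - 1)"
  proof cases
    case 1
    then have "{b \<in> lucas_strings n. b ! 0 = 1} = {}"
      by (auto simp: lucas_strings_def)
    then show ?thesis using 1 by (simp only: card.empty) simp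
  next
    case 2
    then have "{b \<in> lucas_strings n. b ! 0 = 1} = {[1, 0]}"
      by (auto simp: lucas_strings_iff_successively length_Suc_conv numeral_2_eq_2)
    then show ?thesis using 2 by simp
  next
    case (3 m)
    then show ?thesis
      unfolding 3 lucas_strings_head_1
      by (simp add: card_image inj_on_def card_fibonacci_strings)
  qed
  then show ?thesis
    by (simp only: card_lucas_strings_letter[OF assms])
qed

section \<open>The Mostar index\<close>

lemma edge_imbalance_lucas_cube:
  assumes "k < n" "w \<in> lucas_strings n" "w ! k = 1"
  shows "edge_imbalance (lucas_cube n) {w[k := 0], w} = int (fib n)"
proof -
  have "n \<ge> 1" using assms by simp
  obtain m where "n = Suc m" using assms(1) by (cases n) auto
  then have "fib (Suc n) = fib n + fib (n - 1)" by simp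
  then show ?thesis
    unfolding edge_imbalance_doubleton n_closer_lucas_cube[OF \<open>n \<ge> 1\<close> assms]
      card_lucas_strings_0[OF assms(1)] card_lucas_strings_1[OF assms(1)]
    by simp
qed

theorem theorem2:
  fixes n :: nat
  assumes "n \<ge> 1"
  shows "mostar_index (lucas_cube n) = int (n * fib n * fib (n - 1))"
proof -
  let ?tops = "SIGMA k:{..<n}. {w \<in> lucas_strings n. w ! k = 1}"
  have "mostar_index (lucas_cube n) =
      (\<Sum>(k, w)\<in>?tops. edge_imbalance (lucas_cube n) {w[k := 0], w})"
    unfolding mostar_index_def undirected_edges_lucas_cube[OF assms]
    by (subst sum.reindex[OF inj_on_edge_top]) (simp add: case_prod_unfold comp_def)
  also have "\<dots> = (\<Sum>(k, w)\<in>?tops. int (fib n))"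
    by (rule sum.cong) (auto simp: edge_imbalance_lucas_cube)
  also have "\<dots> = int (card ?tops * fib n)"
    by (simp add: case_prod_unfold)
  also have "card ?tops = n * fib (n - 1)"
    by (simp add: card_SigmaI finite_lucas_strings card_lucas_strings_1 del: One_nat_def)
  finally show ?thesis by (simp add: ac_simps)
qed

end
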